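(* For every integer $p\ge 1$ there is a real constant $C_{p,0}$ (depending only on $p$) such that, for every fixed integer $m\ge 1$, as $n\to\infty$, $$\sum_{k=2}^{n-1} \frac{1}{(\log k)^p} =\frac{1}{(p-1)!}\,\mathrm{li}(n) -n \sum_{r=1}^{p-1} \frac{c_{p,r}}{(\log n)^r}+C_{p,0} - \frac{1}{2}\frac{1}{(\log n)^p} -\sum_{k=1}^m \Big(\sum_{r=1}^{2k-1} \frac{d_{p,r,k}}{(\log n)^{r+p}} \Big) \frac{1}{n^{2k-1}} +O\Big(\frac{1}{n^{2m}}\Big),$$ where $c_{p,r}:=\dfrac{(r-1)!}{(p-1)!}$ and $d_{p,r,k}:= \dfrac{B_{2k}}{2k(2k-1)}\,\dfrac{(p-1+r)!}{(p-1)!}\, S_{r-1,1,2k-2}$.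
   Context: $B_{2k}$ are the Bernoulli numbers. $\mathrm{li}(z)=\int_0^z\frac{dt}{\log t}$ (Cauchy principal value for $z>1$) is the logarithmic integral. $S_{r,s,t}:=\sum_{s\le i_1<\dots<i_r\le t}\frac{1}{i_1\cdots i_r}$ (sum over integers), which is $0$ for $r\ge 1$ and $t<r+s-1$; $S_{0,s,t}:=1$ if $t\ge s-1$, and $S_{r,s,t}:=0$ if $r<0$. Empty sums are $0$. *)

theory Defs
  imports "HOL-Analysis.Analysis" "HOL-Library.Landau_Symbols"
begin

text \<open>Bernoulli numbers (with \<open>B\<^sub>1 = - 1 / 2\<close>), through the usual recurrence
  \<open>(\<Sum>k\<le>n. (n + 1 choose k) * B\<^sub>k) = 0\<close> for \<open>n \<ge> 1\<close>, solved for \<open>B\<^sub>n\<close>.\<close>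

fun bernoulli_num :: "nat \<Rightarrow> real" where
  "bernoulli_num 0 = 1"
| "bernoulli_num (Suc n) =
     - (\<Sum>k\<le>n. real ((n + 2) choose k) * bernoulli_num k) / real (n + 2)"

text \<open>For \<open>x > 1\<close> the integral is the Cauchy principal value at the singularity \<open>t = 1\<close>.
  At the endpoint \<open>0\<close> there is no singularity, since \<open>1 / ln t\<close> tends to \<open>0\<close> there.
  The values for \<open>x < 0\<close> and \<open>x = 1\<close> are irrelevant.\<close>

definition li :: "real \<Rightarrow> real" where
  "li x =
     (if x < 1 then integral {0..x} (\<lambda>t. 1 / ln t)
      else Lim (at_right 0)
             (\<lambda>\<epsilon>. integral {0..1 - \<epsilon>} (\<lambda>t. 1 / ln t) + integral {1 + \<epsilon>..x} (\<lambda>t. 1 / ln t)))"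

text \<open>\<open>harmonic_S r s t\<close> is the sum of \<open>1 / (i\<^sub>1 \<cdots> i\<^sub>r)\<close> over all integers
  \<open>s \<le> i\<^sub>1 < \<dots> < i\<^sub>r \<le> t\<close>; a strictly increasing tuple is represented by the set of its entries.\<close>

definition harmonic_S :: "int \<Rightarrow> int \<Rightarrow> int \<Rightarrow> real" where
  "harmonic_S r s t =
     (if r < 0 then 0
      else (\<Sum>I | I \<subseteq> {s..t} \<and> card I = nat r. 1 / (\<Prod>i\<in>I. real_of_int i)))"

definition coeff_c :: "nat \<Rightarrow> nat \<Rightarrow> real" where
  "coeff_c p r = fact (r - 1) / fact (p - 1)"

definition coeff_d :: "nat \<Rightarrow> nat \<Rightarrow> nat \<Rightarrow> real" where
  "coeff_d p r k =
     bernoulli_num (2 * k) / (2 * real k * (2 * real k - 1)) *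
     (fact (p - 1 + r) / fact (p - 1)) *
     harmonic_S (int r - 1) 1 (2 * int k - 2)"

end

theory Submission
  imports Defs "HOL-Real_Asymp.Real_Asymp" "HOL-Combinatorics.Stirling"
begin

text \<open>
  Write \<open>f x = 1 / (ln x) ^ p\<close>. The expansion is the Euler--Maclaurin formula for \<open>f\<close> with three
  ingredients made explicit.

  \<^item> Repeated integration by parts gives the primitive
    \<open>F x = li x / (p - 1)! - x * (\<Sum>r = 1..p - 1. c\<^sub>r / (ln x) ^ r)\<close> of \<open>f\<close> on \<open>x > 1\<close>. To differentiate
    \<open>li\<close>, the principal value is removed: \<open>1 / ln t - 1 / (t - 1)\<close> extends continuously over
    \<open>t = 1\<close>, and \<open>1 / (t - 1)\<close> contributes exactly \<open>ln (x - 1)\<close> (\<open>li_eq_integral_li_kernel\<close>).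

  \<^item> With \<open>u = ln x\<close> and \<open>\<theta> = d/du\<close>, one has
    \<open>x ^ j * (d/dx) ^ j = \<theta> * (\<theta> - 1) * \<cdots> * (\<theta> - j + 1)\<close>, so the \<open>j\<close>-th derivative of \<open>f\<close> has
    Stirling numbers of the first kind as coefficients. These numbers are factorials times
    elementary symmetric functions of the reciprocals \<open>1, 1 / 2, 1 / 3, \<dots>\<close>
    (\<open>stirling_eq_harmonic_S\<close>), which is where the harmonic sums in \<open>coeff_d\<close> come from.

  \<^item> The remainder is obtained without periodic Bernoulli functions. Put
    \<open>G = (\<Sum>j\<le>2 * m. B\<^sub>j / j! * F\<^sup>(\<^sup>j\<^sup>))\<close>. Taylor expansion of each \<open>F\<^sup>(\<^sup>j\<^sup>)\<close> from \<open>n\<close> to \<open>n + 1\<close>,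
    all up to the same derivative of \<open>F\<close>, and the Bernoulli recurrence give
    \<open>G (n + 1) - G n = f n + O(1 / n ^ (2 * m + 1))\<close> (\<open>euler_maclaurin_step\<close>). Hence the difference
    between the sum and \<open>G n\<close> has increments \<open>O(1 / n ^ (2 * m + 1))\<close>, so it converges with error
    \<open>O(1 / n ^ (2 * m))\<close> (\<open>limit_rate_of_increments\<close>).

  The limit does not depend on \<open>m\<close>, because changing \<open>m\<close> only adds or removes terms that tend
  to \<open>0\<close>; it is the constant of the expansion.
\<close>

section \<open>Bernoulli numbers\<close>

lemma bernoulli_num_recurrence:
  "(\<Sum>j\<le>l. real (Suc l choose j) * bernoulli_num j) = (if l = 0 then 1 else 0)"
proof (cases l)
  case (Suc n)
  have "real (n + 2) * bernoulli_num (Suc n) =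
      - (\<Sum>k\<le>n. real ((n + 2) choose k) * bernoulli_num k)"
    by simp
  moreover have "real (n + 2 choose Suc n) = real (n + 2)"
    using binomial_symmetric[of 1 "n + 2"] by simp
  ultimately show ?thesis
    using Suc by (simp del: bernoulli_num.simps binomial_Suc_Suc)
qed simp

text \<open>
  The recurrence says that \<open>B = (\<Sum>n. B\<^sub>n / n! * X ^ n)\<close> satisfies \<open>B * (exp X - 1) = X\<close>.
  Substituting \<open>- X\<close> for \<open>X\<close> and multiplying by \<open>exp X\<close> yields
  \<open>B(- X) * (exp X - 1) = X * exp X\<close>, so that \<open>B(- X) = B(X) + X\<close>.
\<close>

lemma bernoulli_num_odd_eq_0:
  assumes "odd n" "n \<noteq> 1"
  shows "bernoulli_num n = 0"
proof -
  define B :: "real fps" where "B = Abs_fps (\<lambda>n. bernoulli_num n / fact n)"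
  define E :: "real fps" where "E = fps_exp 1"
  have gf: "B * (E - 1) = fps_X"
  proof (rule fps_ext)
    fix n
    show "fps_nth (B * (E - 1)) n = fps_nth fps_X n"
    proof (cases n)
      case (Suc l)
      have "fps_nth (B * (E - 1)) n = (\<Sum>j=0..n. bernoulli_num j / fact j *
          (1 / fact (n - j) - (if n - j = 0 then 1 else 0)))"
        by (simp add: fps_mult_nth B_def E_def)
      also have "\<dots> = (\<Sum>j\<le>l. bernoulli_num j / fact j * (1 / fact (n - j)))"
        by (simp add: Suc atLeast0AtMost mult_ac del: fact_Suc bernoulli_num.simps)
      also have "\<dots> = (\<Sum>j\<le>l. real (Suc l choose j) * bernoulli_num j) / fact n"
        unfolding sum_divide_distrib
        by (intro sum.cong refl)
           (simp add: Suc binomial_fact field_simps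
                 del: fact_Suc bernoulli_num.simps binomial_Suc_Suc)
      finally show ?thesis
        unfolding bernoulli_num_recurrence by (simp add: Suc)
    qed (simp add: B_def E_def)
  qed
  define B' where "B' = fps_compose B (-fps_X)"
  define E' :: "real fps" where "E' = fps_exp (-1)"
  have EE': "E * E' = 1"
    using fps_exp_add_mult[of 1 "-1::real"] by (simp add: E_def E'_def)
  have "fps_compose (B * (E - 1)) (-fps_X) = fps_compose fps_X (-fps_X :: real fps)"
    by (simp only: gf)
  hence "B' * (E' - 1) = - fps_X"
    by (simp add: B'_def E'_def E_def fps_compose_mult_distrib fps_compose_sub_distrib)
  hence "B' * (E' - 1) * E = - fps_X * E" by simp
  hence "B' * (E - 1) = fps_X * E"
    using EE' by (simp add: algebra_simps)
  hence "(B' - B - fps_X) * (E - 1) = 0"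
    using gf by (simp add: algebra_simps)
  moreover have "E - 1 \<noteq> 0" by (simp add: E_def)
  ultimately have "B' - B - fps_X = 0" using mult_eq_0_iff by blast
  hence "B' = B + fps_X" by (simp add: algebra_simps)
  hence "fps_nth B' n = fps_nth B n + fps_nth fps_X n" by simp
  hence "- bernoulli_num n / fact n = bernoulli_num n / fact n"
    using assms by (simp add: B'_def B_def fps_compose_uminus')
  thus ?thesis by (simp add: field_simps)
qed

section \<open>One step of Euler--Maclaurin summation\<close>

text \<open>
  Here \<open>D 0\<close> is a primitive of the summand \<open>D 1\<close>, and \<open>D (Suc j)\<close> is the derivative of \<open>D j\<close>. After
  Taylor expansion of \<open>D j (a + 1)\<close> around \<open>a\<close>, the coefficient of \<open>D (Suc l) a\<close> in the sum is
  \<open>(\<Sum>j\<le>l. (Suc l choose j) * B\<^sub>j) / (Suc l)!\<close>, which vanishes unless \<open>l = 0\<close>.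
\<close>

lemma euler_maclaurin_step:
  fixes D :: "nat \<Rightarrow> real \<Rightarrow> real"
  assumes "N \<ge> 1"
  assumes deriv: "\<And>j t. j \<le> N \<Longrightarrow> a \<le> t \<Longrightarrow> t \<le> a + 1 \<Longrightarrow>
                    (D j has_real_derivative D (Suc j) t) (at t)"
  assumes bound: "\<And>t. a \<le> t \<Longrightarrow> t \<le> a + 1 \<Longrightarrow> \<bar>D (Suc N) t\<bar> \<le> M"
  shows "\<bar>(\<Sum>j<N. bernoulli_num j / fact j * (D j (a + 1) - D j a)) - D 1 a\<bar>
           \<le> (\<Sum>j<N. \<bar>bernoulli_num j\<bar> / fact j) * M"
proof -
  \<comment> \<open>The Taylor polynomial of \<open>D j\<close> at \<open>a\<close> without its constant term. Its length depends on \<open>j\<close>, so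
      that each remainder involves the same function \<open>D (Suc N)\<close>.\<close>
  define T where "T j = (\<Sum>i<N - j. D (Suc (j + i)) a / fact (Suc i))" for j
  have M: "M \<ge> 0" using bound[of a] by simp
  have taylor: "\<bar>D j (a + 1) - D j a - T j\<bar> \<le> M" if "j < N" for j
  proof -
    have index: "j + Suc (N - j) = Suc N" using that by simp
    have "\<exists>t. a < t \<and> t < a + 1 \<and> D j (a + 1) =
        (\<Sum>i<Suc (N - j). (D (j + i) a / fact i) * (a + 1 - a) ^ i) +
        (D (j + Suc (N - j)) t / fact (Suc (N - j))) * (a + 1 - a) ^ Suc (N - j)"
      by (rule Taylor_up[where diff = "\<lambda>i. D (j + i)" and a = a])
         (use that deriv in auto)
    then obtain t where t: "a < t" "t < a + 1" and eq: "D j (a + 1) =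
        (\<Sum>i<Suc (N - j). D (j + i) a / fact i) + D (Suc N) t / fact (Suc (N - j))"
      by (auto simp: index simp del: fact_Suc sum.lessThan_Suc add_Suc_right)
    have "D j (a + 1) - D j a - T j = D (Suc N) t / fact (Suc (N - j))"
      unfolding eq sum.lessThan_Suc_shift T_def by (simp del: fact_Suc)
    also have "\<bar>\<dots>\<bar> \<le> \<bar>D (Suc N) t\<bar> / 1"
      unfolding abs_divide by (intro frac_le) (auto simp del: fact_Suc)
    also have "\<dots> \<le> M" using bound[of t] t by simp
    finally show ?thesis .
  qed
  have "(\<Sum>j<N. bernoulli_num j / fact j * T j) =
      (\<Sum>j<N. \<Sum>i<N - j. bernoulli_num j / fact j * (D (Suc (j + i)) a / fact (Suc i)))"
    by (simp add: T_def sum_distrib_left)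
  also have "\<dots> = (\<Sum>(j,i)\<in>{(j,i). j + i < N}.
        bernoulli_num j / fact j * (D (Suc (j + i)) a / fact (Suc i)))"
    by (subst sum.Sigma) (auto intro!: sum.cong)
  also have "\<dots> = (\<Sum>l<N. \<Sum>j\<le>l.
        bernoulli_num j / fact j * (D (Suc (j + (l - j))) a / fact (Suc (l - j))))"
    by (rule sum.triangle_reindex)
  also have "\<dots> = (\<Sum>l<N. D (Suc l) a / fact (Suc l) *
                     (\<Sum>j\<le>l. real (Suc l choose j) * bernoulli_num j))"
    unfolding sum_distrib_left
    by (intro sum.cong refl)
       (simp add: binomial_fact Suc_diff_le field_simps
             del: fact_Suc bernoulli_num.simps binomial_Suc_Suc)
  also have "\<dots> = (\<Sum>l<N. if l = 0 then D 1 a else 0)"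
    unfolding bernoulli_num_recurrence by (intro sum.cong refl) auto
  also have "\<dots> = D 1 a" using \<open>N \<ge> 1\<close> by simp
  finally have main: "(\<Sum>j<N. bernoulli_num j / fact j * T j) = D 1 a" .
  have "(\<Sum>j<N. bernoulli_num j / fact j * (D j (a + 1) - D j a)) - D 1 a =
        (\<Sum>j<N. bernoulli_num j / fact j * (D j (a + 1) - D j a - T j))"
    using main by (simp add: right_diff_distrib sum_subtractf)
  also have "\<bar>\<dots>\<bar> \<le> (\<Sum>j<N. \<bar>bernoulli_num j\<bar> / fact j * M)"
  proof (intro order.trans[OF sum_abs] sum_mono)
    fix j assume "j \<in> {..<N}"
    thus "\<bar>bernoulli_num j / fact j * (D j (a + 1) - D j a - T j)\<bar> \<le> \<bar>bernoulli_num j\<bar> / fact j * M"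
      unfolding abs_mult using taylor[of j] by (intro mult_mono) auto
  qed
  finally show ?thesis by (simp add: sum_distrib_right)
qed

text \<open>
  For \<open>k \<ge> n\<close> the increment is at most \<open>K / n ^ (q - 1) * (1 / k\<^sup>2)\<close>, and
  \<open>1 / k\<^sup>2 \<le> 2 * (1 / k - 1 / (k + 1))\<close> makes the sum of these bounds telescope.
\<close>

lemma limit_rate_of_increments:
  fixes E :: "nat \<Rightarrow> real"
  assumes "q \<ge> 1" "N \<ge> 1"
  assumes incr: "\<And>k. k \<ge> N \<Longrightarrow> \<bar>E (Suc k) - E k\<bar> \<le> K / real k ^ Suc q"
  shows "\<exists>C. E \<longlonglongrightarrow> C \<and> (\<forall>n\<ge>N. \<bar>E n - C\<bar> \<le> 2 * K / real n ^ q)"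
proof -
  have "0 \<le> K / real N ^ Suc q" using incr[of N] by linarith
  moreover have "0 < real N ^ Suc q" using \<open>N \<ge> 1\<close> by simp
  ultimately have K: "K \<ge> 0" unfolding zero_le_divide_iff by linarith
  have tele: "\<bar>E (n + d) - E n\<bar> \<le> 2 * K / real n ^ (q - 1) * (1 / real n - 1 / real (n + d))"
    if n: "n \<ge> N" for n d
  proof (induction d)
    case (Suc d)
    let ?k = "real (n + d)"
    have k: "?k \<ge> real n" "real n \<ge> 1" using n \<open>N \<ge> 1\<close> by auto
    have pow: "?k ^ Suc q = ?k ^ (q - 1) * ?k\<^sup>2"
      using \<open>q \<ge> 1\<close> by (simp flip: power_add)
    have "\<bar>E (Suc (n + d)) - E (n + d)\<bar> \<le> K / ?k ^ (q - 1) * (1 / ?k\<^sup>2)"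
      using incr[of "n + d"] n unfolding pow by simp
    also have "\<dots> \<le> K / real n ^ (q - 1) * (2 * (1 / ?k - 1 / (?k + 1)))"
    proof (intro mult_mono)
      show "K / ?k ^ (q - 1) \<le> K / real n ^ (q - 1)"
        using k K by (intro divide_left_mono power_mono mult_pos_pos zero_less_power) auto
      have "1 / ?k - 1 / (?k + 1) = 1 / (?k * (?k + 1))"
        using k by (simp add: field_simps)
      moreover have "?k * (?k + 1) \<le> 2 * ?k\<^sup>2"
        using k mult_left_mono[of 1 ?k ?k] by (simp add: power2_eq_square algebra_simps del: of_nat_add)
      hence "1 / (2 * ?k\<^sup>2) \<le> 1 / (?k * (?k + 1))"
        using k by (intro divide_left_mono mult_pos_pos) auto
      ultimately show "1 / ?k\<^sup>2 \<le> 2 * (1 / ?k - 1 / (?k + 1))"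
        by simp
    qed (use k K in auto)
    finally have "\<bar>E (Suc (n + d)) - E (n + d)\<bar> \<le>
        2 * K / real n ^ (q - 1) * (1 / ?k - 1 / (?k + 1))" by (simp add: mult_ac)
    with Suc.IH have "\<bar>E (n + Suc d) - E n\<bar> \<le>
        2 * K / real n ^ (q - 1) * (1 / real n - 1 / ?k) +
        2 * K / real n ^ (q - 1) * (1 / ?k - 1 / (?k + 1))"
      by simp
    thus ?case unfolding distrib_left[symmetric] by (simp add: add_ac)
  qed simp
  have dist: "\<bar>E k - E n\<bar> \<le> 2 * K / real n ^ q" if "n \<ge> N" "k \<ge> n" for n k
  proof -
    have n: "real n > 0" using that \<open>N \<ge> 1\<close> by simp
    have "\<bar>E (n + (k - n)) - E n\<bar> \<le> 2 * K / real n ^ (q - 1) * (1 / real n - 1 / real (n + (k - n)))"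
      by (rule tele[OF that(1)])
    also have "\<dots> \<le> 2 * K / real n ^ (q - 1) * (1 / real n)"
      using K by (intro mult_left_mono) auto
    also have "\<dots> = 2 * K / real n ^ q"
      using \<open>q \<ge> 1\<close> by (cases q) (auto simp: mult_ac)
    finally show ?thesis using that by simp
  qed
  have "(\<lambda>n. 2 * K / real n ^ q) \<longlonglongrightarrow> 0"
    using \<open>q \<ge> 1\<close> by real_asymp
  have "Cauchy E"
  proof (rule CauchyI')
    fix e :: real assume "e > 0"
    have "\<forall>\<^sub>F n in sequentially. 2 * K / real n ^ q < e"
      using \<open>(\<lambda>n. 2 * K / real n ^ q) \<longlonglongrightarrow> 0\<close> \<open>e > 0\<close> by (rule order_tendstoD)
    hence "\<forall>\<^sub>F n in sequentially. n \<ge> N \<and> 2 * K / real n ^ q < e"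
      using eventually_ge_at_top[of N] by eventually_elim auto
    then obtain n where n: "\<And>k. k \<ge> n \<Longrightarrow> k \<ge> N \<and> 2 * K / real k ^ q < e"
      unfolding eventually_sequentially by blast
    show "\<exists>M. \<forall>m\<ge>M. \<forall>n>m. dist (E m) (E n) < e"
    proof (intro exI[of _ n] allI impI)
      fix i j assume "i \<ge> n" "j > i"
      thus "dist (E i) (E j) < e"
        using dist[of i j] n[of i] by (simp add: dist_real_def abs_minus_commute)
    qed
  qed
  then obtain C where C: "E \<longlonglongrightarrow> C"
    by (auto simp: Cauchy_convergent_iff convergent_def)
  have "\<bar>E n - C\<bar> \<le> 2 * K / real n ^ q" if "n \<ge> N" for n
  proof -
    have "(\<lambda>k. \<bar>E k - E n\<bar>) \<longlonglongrightarrow> \<bar>C - E n\<bar>"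
      by (intro tendsto_intros C)
    hence "\<bar>C - E n\<bar> \<le> 2 * K / real n ^ q"
      by (rule LIMSEQ_le_const2) (use dist[OF that] in blast)
    thus ?thesis by (simp add: abs_minus_commute)
  qed
  with C show ?thesis by blast
qed

section \<open>The logarithmic integral\<close>

text \<open>
  The integrand of \<open>li\<close> without its pole at \<open>1\<close>; the value \<open>1 / 2\<close> is the limit there. At \<open>0\<close> the
  conventions \<open>ln 0 = 0\<close> and \<open>1 / 0 = 0\<close> give the value \<open>1\<close>, which is again the limit.
\<close>

definition li_kernel :: "real \<Rightarrow> real" where
  "li_kernel t = (if t = 1 then 1 / 2 else 1 / ln t - 1 / (t - 1))"

lemma continuous_on_li_kernel: "continuous_on {0..x} li_kernel"
  unfolding continuous_on_def
proof
  fix t assume t: "t \<in> {0..x}"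
  have off_one: "\<forall>\<^sub>F u in at t within A. li_kernel u = 1 / ln u - 1 / (u - 1)" for A
  proof -
    have "\<forall>\<^sub>F u in at t within A. u \<noteq> 1"
      by (rule eventually_neq_at_within)
    thus ?thesis by eventually_elim (simp add: li_kernel_def)
  qed
  consider "t = 0" | "t = 1" | "t > 0" "t \<noteq> 1" using t by force
  then show "(li_kernel \<longlongrightarrow> li_kernel t) (at t within {0..x})"
  proof cases
    case 1
    have "((\<lambda>u::real. 1 / ln u - 1 / (u - 1)) \<longlongrightarrow> 1) (at_right 0)"
      by real_asymp
    hence "(li_kernel \<longlongrightarrow> 1) (at_right 0)"
      using off_one[of "{0<..}"] 1 by (simp cong: tendsto_cong)
    moreover have "at 0 within {0..x} \<le> at_right (0::real)"
      unfolding at_within_def by (intro inf_mono order_refl) auto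
    ultimately show ?thesis using 1 by (auto simp: li_kernel_def intro: tendsto_mono)
  next
    case 2
    have "((\<lambda>u::real. 1 / ln u - 1 / (u - 1)) \<longlongrightarrow> 1/2) (at 1)"
      unfolding filterlim_at_split by (auto; real_asymp)
    hence "(li_kernel \<longlongrightarrow> 1/2) (at 1)"
      using off_one[of UNIV] 2 by (simp cong: tendsto_cong)
    thus ?thesis using 2 by (auto simp: li_kernel_def intro: tendsto_within_subset)
  next
    case 3
    have "((\<lambda>u. 1 / ln u - 1 / (u - 1)) \<longlongrightarrow> 1 / ln t - 1 / (t - 1)) (at t)"
      using 3 by (intro tendsto_intros) auto
    hence "(li_kernel \<longlongrightarrow> 1 / ln t - 1 / (t - 1)) (at t)"
      using off_one[of UNIV] by (simp cong: tendsto_cong)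
    thus ?thesis using 3 by (auto simp: li_kernel_def intro: tendsto_within_subset)
  qed
qed

text \<open>
  The integrals of \<open>1 / (t - 1)\<close> over \<open>{0..1 - \<epsilon>}\<close> and \<open>{1 + \<epsilon>..x}\<close> are \<open>ln \<epsilon>\<close> and
  \<open>ln (x - 1) - ln \<epsilon>\<close>: the divergent parts cancel exactly, which shows that the principal value
  exists and evaluates it.
\<close>

lemma li_eq_integral_li_kernel:
  assumes x: "x > 1"
  shows "li x = integral {0..x} li_kernel + ln (x - 1)"
proof -
  define I where "I y = integral {0..y} li_kernel" for y
  have int: "li_kernel integrable_on {a..b}" if "0 \<le> a" for a b
    by (rule integrable_continuous_real, rule continuous_on_subset[OF continuous_on_li_kernel[of b]])
       (use that in auto)
  have left: "integral {0..1 - \<epsilon>} (\<lambda>t. 1 / ln t) = I (1 - \<epsilon>) + ln \<epsilon>" if "0 < \<epsilon>" "\<epsilon> < 1" for \<epsilon>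
  proof -
    have "((\<lambda>t. 1 / (t - 1)) has_integral (ln (1 - (1 - \<epsilon>)) - ln (1 - 0))) {0..1 - \<epsilon>}"
      using that by (intro fundamental_theorem_of_calculus)
        (auto intro!: derivative_eq_intros
              simp flip: has_real_derivative_iff_has_vector_derivative simp: divide_simps)
    hence "((\<lambda>t. li_kernel t + 1 / (t - 1)) has_integral (I (1 - \<epsilon>) + ln \<epsilon>)) {0..1 - \<epsilon>}"
      using int[of 0 "1 - \<epsilon>"] unfolding I_def
      by (intro has_integral_add) (auto intro: integrable_integral)
    hence "((\<lambda>t. 1 / ln t) has_integral (I (1 - \<epsilon>) + ln \<epsilon>)) {0..1 - \<epsilon>}"
      by (rule has_integral_eq[rotated]) (use that in \<open>auto simp: li_kernel_def\<close>)
    thus ?thesis by (rule integral_unique)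
  qed
  have right: "integral {1 + \<epsilon>..x} (\<lambda>t. 1 / ln t) = I x - I (1 + \<epsilon>) + (ln (x - 1) - ln \<epsilon>)"
    if "0 < \<epsilon>" "\<epsilon> < x - 1" for \<epsilon>
  proof -
    have "((\<lambda>t. 1 / (t - 1)) has_integral (ln (x - 1) - ln (1 + \<epsilon> - 1))) {1 + \<epsilon>..x}"
      using that by (intro fundamental_theorem_of_calculus)
        (auto intro!: derivative_eq_intros
              simp flip: has_real_derivative_iff_has_vector_derivative)
    moreover have "integral {1 + \<epsilon>..x} li_kernel = I x - I (1 + \<epsilon>)"
      using Henstock_Kurzweil_Integration.integral_combine[of 0 "1 + \<epsilon>" x li_kernel] int[of 0 x] that by (simp add: I_def)
    ultimately have "((\<lambda>t. li_kernel t + 1 / (t - 1)) has_integral (I x - I (1 + \<epsilon>) + (ln (x - 1) - ln \<epsilon>))) {1 + \<epsilon>..x}"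
      using int[of "1 + \<epsilon>" x] that
      by (intro has_integral_add) (auto intro: integrable_integral simp flip: \<open>_ = I x - I (1 + \<epsilon>)\<close>)
    hence "((\<lambda>t. 1 / ln t) has_integral (I x - I (1 + \<epsilon>) + (ln (x - 1) - ln \<epsilon>))) {1 + \<epsilon>..x}"
      by (rule has_integral_eq[rotated]) (use that in \<open>auto simp: li_kernel_def\<close>)
    thus ?thesis by (rule integral_unique)
  qed
  have "continuous_on {0..x} I"
    unfolding I_def by (rule indefinite_integral_continuous_1[OF int]) simp
  hence "isCont I 1"
    by (rule continuous_on_interior) (use x in auto)
  hence I1: "((\<lambda>\<epsilon>. I (f \<epsilon>)) \<longlongrightarrow> I 1) F" if "(f \<longlongrightarrow> 1) F" for f and F :: "real filter"
    using that by (rule isCont_tendsto_compose)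
  have "((\<lambda>\<epsilon>. I (1 - \<epsilon>) + (I x - I (1 + \<epsilon>) + ln (x - 1))) \<longlongrightarrow> I 1 + (I x - I 1 + ln (x - 1))) (at_right 0)"
    by (intro tendsto_intros I1; real_asymp)
  moreover have "\<forall>\<^sub>F \<epsilon> in at_right 0. I (1 - \<epsilon>) + (I x - I (1 + \<epsilon>) + ln (x - 1)) =
      integral {0..1 - \<epsilon>} (\<lambda>t. 1 / ln t) + integral {1 + \<epsilon>..x} (\<lambda>t. 1 / ln t)"
    using eventually_at_right_real[of 0 "min 1 (x - 1)"] x
    by (auto elim!: eventually_mono simp: left right)
  ultimately have "((\<lambda>\<epsilon>. integral {0..1 - \<epsilon>} (\<lambda>t. 1 / ln t) + integral {1 + \<epsilon>..x} (\<lambda>t. 1 / ln t))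
      \<longlongrightarrow> I 1 + (I x - I 1 + ln (x - 1))) (at_right 0)"
    by (rule Lim_transform_eventually)
  hence "li x = I 1 + (I x - I 1 + ln (x - 1))"
    unfolding li_def using x by (simp add: tendsto_Lim)
  thus ?thesis by (simp add: I_def)
qed

lemma has_real_derivative_li:
  assumes x: "x > 1"
  shows "(li has_real_derivative 1 / ln x) (at x)"
proof -
  have "((\<lambda>y. integral {0..y} li_kernel) has_real_derivative li_kernel x) (at x within {0..x + 1})"
    by (rule integral_has_real_derivative[OF continuous_on_li_kernel]) (use x in auto)
  hence "((\<lambda>y. integral {0..y} li_kernel) has_real_derivative li_kernel x) (at x)"
    using x by (simp add: at_within_Icc_at)
  hence "((\<lambda>y. integral {0..y} li_kernel + ln (y - 1)) has_real_derivative 1 / ln x) (at x)"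
    using x by (auto intro!: derivative_eq_intros simp: li_kernel_def)
  moreover have "\<forall>\<^sub>F y in nhds x. integral {0..y} li_kernel + ln (y - 1) = li y"
    using eventually_nhds_in_open[of "{1<..}" x] x
    by (auto elim!: eventually_mono simp: li_eq_integral_li_kernel)
  ultimately show ?thesis by (subst DERIV_cong_ev[OF refl _ refl]) (auto simp: eq_commute)
qed

section \<open>Iterated derivatives of powers of the inverse logarithm\<close>

text \<open>
  The \<open>j\<close>-th derivative of \<open>1 / (ln x) ^ p\<close>, in closed form. In the variable \<open>u = ln x\<close> it is
  \<open>x powr (- j)\<close> times \<open>\<theta> * (\<theta> - 1) * \<cdots> * (\<theta> - j + 1)\<close> applied to \<open>u powr (- p)\<close>, where
  \<open>\<theta> = d/du\<close>. The unsigned Stirling numbers are, up to the sign \<open>(-1) ^ (j - r)\<close>, the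
  coefficients of \<open>\<theta> ^ r\<close> in this operator, and \<open>\<theta> ^ r\<close> multiplies \<open>u powr (- p)\<close> by
  \<open>(-1) ^ r * pochhammer p r / u ^ r\<close>; the signs combine to \<open>(-1) ^ j\<close>.
\<close>

definition inv_ln_power_deriv :: "nat \<Rightarrow> nat \<Rightarrow> real \<Rightarrow> real" where
  "inv_ln_power_deriv p j x =
     (-1) ^ j * (\<Sum>r\<le>j. real (stirling j r) * pochhammer (real p) r / ln x ^ (p + r)) / x ^ j"

lemma has_real_derivative_inv_ln_power:
  assumes "x > 1"
  shows "((\<lambda>x. 1 / ln x ^ n) has_real_derivative - (real n / ln x ^ Suc n) / x) (at x)"
proof (cases n)
  case (Suc k)
  have "((\<lambda>x. 1 / ln x) has_real_derivative - (1 / (x * (ln x)\<^sup>2))) (at x)"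
    using assms by (auto intro!: derivative_eq_intros simp: power2_eq_square)
  from DERIV_power_Suc[OF this, of k] show ?thesis
    by (simp add: Suc power_divide power2_eq_square mult_ac)
qed simp

text \<open>
  Differentiating the factor \<open>1 / x ^ j\<close> multiplies the numerator by \<open>j\<close>, differentiating the
  logarithms raises \<open>r\<close> by one: together this is the recurrence
  \<open>stirling (Suc j) (Suc r) = j * stirling j (Suc r) + stirling j r\<close>.
\<close>

lemma has_real_derivative_inv_ln_power_deriv:
  assumes x: "x > 1"
  shows "(inv_ln_power_deriv p j has_real_derivative inv_ln_power_deriv p (Suc j) x) (at x)"
proof -
  define a where "a i r = real (stirling i r) * pochhammer (real p) r" for i r
  define S where "S i y = (\<Sum>r\<le>i. a i r * (1 / ln y ^ (p + r)))" for i y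
  define T where "T = (\<Sum>r\<le>j. a j r * (real (p + r) / ln x ^ Suc (p + r)))"
  have "(S j has_real_derivative (\<Sum>r\<le>j. a j r * (- (real (p + r) / ln x ^ Suc (p + r)) / x))) (at x)"
    unfolding S_def
    by (intro DERIV_sum DERIV_cmult has_real_derivative_inv_ln_power x)
  hence S': "(S j has_real_derivative - T / x) (at x)"
    by (simp add: T_def sum_negf sum_divide_distrib)
  have a0: "real j * a j 0 = 0" by (cases j) (simp_all add: a_def)
  have aSuc: "a (Suc j) (Suc r) = real j * a j (Suc r) + real (p + r) * a j r" for r
    by (simp add: a_def pochhammer_Suc algebra_simps)
  have "S (Suc j) x = (\<Sum>r\<le>j. a (Suc j) (Suc r) * (1 / ln x ^ (p + Suc r)))"
    unfolding S_def sum.atMost_Suc_shift by (simp add: a_def)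
  also have "\<dots> = real j * (\<Sum>r\<le>j. a j (Suc r) * (1 / ln x ^ (p + Suc r))) +
                   (\<Sum>r\<le>j. a j r * (real (p + r) / ln x ^ Suc (p + r)))"
    by (simp add: aSuc sum_distrib_left sum.distrib [symmetric] add_divide_distrib algebra_simps)
  also have "real j * (\<Sum>r\<le>j. a j (Suc r) * (1 / ln x ^ (p + Suc r))) =
             real j * (\<Sum>r\<le>Suc j. a j r * (1 / ln x ^ (p + r)))"
    unfolding sum.atMost_Suc_shift[where n = j] using a0 by (simp add: algebra_simps)
  also have "\<dots> = real j * S j x"
    by (simp add: S_def a_def)
  finally have rec: "S (Suc j) x = real j * S j x + T"
    unfolding T_def .
  have eq: "inv_ln_power_deriv p i = (\<lambda>y. (-1) ^ i * S i y / y ^ i)" for i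
    by (simp add: inv_ln_power_deriv_def S_def a_def fun_eq_iff)
  have "((\<lambda>y. (-1) ^ j * S j y / y ^ j) has_real_derivative
          (-1) ^ Suc j * (real j * S j x + T) / x ^ Suc j) (at x)"
  proof (cases j)
    case 0
    show ?thesis using S' by (simp add: 0)
  next
    case (Suc i)
    show ?thesis
      by (rule derivative_eq_intros S' refl)+ (use x in \<open>simp_all add: Suc field_simps\<close>)
  qed
  thus ?thesis unfolding eq rec .
qed

text \<open>
  From \<open>3 \<ge> exp 1\<close> on, the logarithm is at least \<open>1\<close> and its powers can be dropped from the
  denominators, which leaves the decay \<open>1 / x ^ j\<close> that bounds the remainder.
\<close>

lemma abs_inv_ln_power_deriv_le:
  assumes "x \<ge> 3"
  shows "\<bar>inv_ln_power_deriv p j x\<bar> \<le> (\<Sum>r\<le>j. real (stirling j r) * pochhammer (real p) r) / x ^ j"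
proof -
  have "exp 1 \<le> x" using exp_le assms by linarith
  hence ln: "ln x \<ge> 1" using assms by (simp add: ln_ge_iff)
  have poch: "pochhammer (real p) r \<ge> 0" for r
    by (simp add: pochhammer_of_nat)
  have "\<bar>inv_ln_power_deriv p j x\<bar> =
      (\<Sum>r\<le>j. real (stirling j r) * pochhammer (real p) r / ln x ^ (p + r)) / x ^ j"
    using assms ln poch
    by (simp add: inv_ln_power_deriv_def abs_mult power_abs abs_of_nonneg sum_nonneg)
  also have "\<dots> \<le> (\<Sum>r\<le>j. real (stirling j r) * pochhammer (real p) r / 1) / x ^ j"
    using assms ln poch
    by (intro divide_right_mono sum_mono divide_left_mono one_le_power mult_nonneg_nonneg) auto
  finally show ?thesis by simp
qed

text \<open>
  The sets of indices are split according to whether they contain the largest index \<open>Suc j\<close>.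
\<close>

lemma harmonic_S_Suc:
  "harmonic_S (int (Suc r)) 1 (int (Suc j)) =
     harmonic_S (int (Suc r)) 1 (int j) + harmonic_S (int r) 1 (int j) / real (Suc j)"
proof -
  let ?x = "int (Suc j)" and ?A = "{1..int j}"
  let ?P = "\<lambda>k. {I. I \<subseteq> ?A \<and> card I = k}"
  define w where "w I = 1 / (\<Prod>i\<in>I. real_of_int i)" for I :: "int set"
  have fin: "finite I" if "I \<subseteq> ?A" for I using that by (rule finite_subset) simp
  have ins: "{1..?x} = insert ?x ?A" by auto
  have inj: "inj_on (insert ?x) (?P r)"
    by (rule inj_onI)
       (metis (no_types, lifting) Diff_insert_absorb atLeastAtMost_iff lessI mem_Collect_eq not_less of_nat_less_iff subsetD)
  have "{I. I \<subseteq> {1..?x} \<and> card I = Suc r} = ?P (Suc r) \<union> insert ?x ` ?P r"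
  proof (intro equalityI subsetI)
    fix I assume I: "I \<in> {I. I \<subseteq> {1..?x} \<and> card I = Suc r}"
    show "I \<in> ?P (Suc r) \<union> insert ?x ` ?P r"
    proof (cases "?x \<in> I")
      case True
      have "finite I" using I by (auto intro: finite_subset)
      hence "I = insert ?x (I - {?x}) \<and> I - {?x} \<in> ?P r"
        using I True unfolding ins by (auto simp: card_Diff_singleton)
      thus ?thesis by blast
    next
      case False
      thus ?thesis using I unfolding ins by auto
    qed
  next
    fix I assume "I \<in> ?P (Suc r) \<union> insert ?x ` ?P r"
    thus "I \<in> {I. I \<subseteq> {1..?x} \<and> card I = Suc r}"
    proof
      assume "I \<in> insert ?x ` ?P r"
      then obtain J where J: "I = insert ?x J" "J \<subseteq> ?A" "card J = r" by auto
      moreover have "?x \<notin> J" using J by auto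
      ultimately show ?thesis using fin[of J] unfolding ins by auto
    qed (auto simp: ins)
  qed
  moreover have "?P (Suc r) \<inter> insert ?x ` ?P r = {}" by auto
  moreover have "finite (?P k)" for k
    by (rule finite_subset[of _ "Pow ?A"]) auto
  ultimately have "(\<Sum>I | I \<subseteq> {1..?x} \<and> card I = Suc r. w I) =
      (\<Sum>I\<in>?P (Suc r). w I) + (\<Sum>I\<in>insert ?x ` ?P r. w I)"
    by (simp add: sum.union_disjoint)
  also have "(\<Sum>I\<in>insert ?x ` ?P r. w I) = (\<Sum>I\<in>?P r. w (insert ?x I))"
    by (simp only: sum.reindex[OF inj] o_def)
  also have "\<dots> = (\<Sum>I\<in>?P r. w I / real (Suc j))"
  proof (intro sum.cong refl)
    fix I assume I: "I \<in> ?P r"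
    hence "?x \<notin> I" by auto
    thus "w (insert ?x I) = w I / real (Suc j)" using I fin[of I] by (simp add: w_def mult_ac)
  qed
  finally show ?thesis
    by (simp add: harmonic_S_def w_def sum_divide_distrib nat_add_distrib)
qed

lemma harmonic_S_0: "harmonic_S 0 1 t = 1"
proof -
  have "{I. I \<subseteq> {1..t} \<and> card I = 0} = {{}}"
    using finite_subset[of _ "{1..t}"] by auto
  thus ?thesis by (simp add: harmonic_S_def)
qed

text \<open>
  Both sides satisfy the same recurrence. It expresses that \<open>stirling (Suc j) (Suc r)\<close> is the
  coefficient of \<open>X ^ r\<close> in \<open>(X + 1) * \<cdots> * (X + j) = j! * (1 + X / 1) * \<cdots> * (1 + X / j)\<close>.
\<close>

lemma stirling_eq_harmonic_S:
  "real (stirling (Suc j) (Suc r)) = fact j * harmonic_S (int r) 1 (int j)"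
proof (induction j arbitrary: r)
  case 0
  have "{I :: int set. I = {} \<and> card I = r} = (if r = 0 then {{}} else {})" by auto
  thus ?case by (cases r) (auto simp: harmonic_S_def)
next
  case (Suc j)
  show ?case
  proof (cases r)
    case 0
    thus ?thesis by (simp add: harmonic_S_0 stirling_Suc_n_1 algebra_simps del: stirling.simps)
  next
    case r: (Suc q)
    have "real (stirling (Suc (Suc j)) (Suc r)) =
        real (Suc j) * real (stirling (Suc j) (Suc r)) + real (stirling (Suc j) r)"
      unfolding r by (simp only: stirling.simps(4)[of "Suc j"] of_nat_add of_nat_mult)
    also have "\<dots> = real (Suc j) * (fact j * harmonic_S (int r) 1 (int j)) + fact j * harmonic_S (int q) 1 (int j)"
      unfolding r by (simp only: Suc.IH)
    also have "\<dots> = fact (Suc j) * harmonic_S (int r) 1 (int (Suc j))"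
      unfolding r harmonic_S_Suc by (simp add: field_simps)
    finally show ?thesis .
  qed
qed

text \<open>
  The Euler--Maclaurin terms are the terms of the expansion: the derivative has odd order, which
  gives the minus sign, and \<open>(2 * k)! = 2 * k * (2 * k - 1) * (2 * k - 2)!\<close> cancels the factorial
  from the Stirling numbers.
\<close>

lemma bernoulli_term_eq:
  assumes "p \<ge> 1" "k \<ge> 1"
  shows "bernoulli_num (2 * k) / fact (2 * k) * inv_ln_power_deriv p (2 * k - 1) x =
         - ((\<Sum>r = 1..2 * k - 1. coeff_d p r k / ln x ^ (r + p)) * (1 / x ^ (2 * k - 1)))"
proof -
  define j where "j = 2 * k - 2"
  have k: "2 * k - 1 = Suc j" "2 * k = Suc (Suc j)" "2 * int k - 2 = int j" "2 * real k = real (Suc (Suc j))"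
    using assms by (auto simp: j_def)
  have "odd (Suc j)" using k(2) by presburger
  have fact_2k: "fact (2 * k) = real (Suc (Suc j)) * (real (Suc (Suc j)) - 1) * fact j"
    unfolding k(2) by (simp add: algebra_simps)
  have poch: "pochhammer (real p) r = fact (p - 1 + r) / fact (p - 1)" for r
    using pochhammer_product'[of "1::real" "p - 1" r] assms
    by (simp add: pochhammer_fact[symmetric])
  have "inv_ln_power_deriv p (Suc j) x =
      - (\<Sum>r\<le>Suc j. real (stirling (Suc j) r) * pochhammer (real p) r / ln x ^ (p + r)) / x ^ Suc j"
    using \<open>odd (Suc j)\<close> by (simp add: inv_ln_power_deriv_def del: stirling.simps sum.atMost_Suc)
  also have "(\<Sum>r\<le>Suc j. real (stirling (Suc j) r) * pochhammer (real p) r / ln x ^ (p + r)) =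
      (\<Sum>r\<le>j. real (stirling (Suc j) (Suc r)) * pochhammer (real p) (Suc r) / ln x ^ (p + Suc r))"
    unfolding sum.atMost_Suc_shift by simp
  finally have deriv: "inv_ln_power_deriv p (Suc j) x =
      - (\<Sum>r\<le>j. real (stirling (Suc j) (Suc r)) * pochhammer (real p) (Suc r) / ln x ^ (p + Suc r)) / x ^ Suc j" .
  have "bernoulli_num (2 * k) / fact (2 * k) *
      (real (stirling (Suc j) (Suc r)) * pochhammer (real p) (Suc r) / ln x ^ (p + Suc r)) =
      coeff_d p (Suc r) k / ln x ^ (Suc r + p)" for r
  proof -
    have cancel: "b / (w * f) * (f * h * q / l) = b / w * q * h / l" if "f \<noteq> 0" for b f h l q w :: real
      using that by simp
    have index: "int (Suc r) - 1 = int r" by simp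
    show ?thesis
      unfolding coeff_d_def fact_2k k(3,4) index stirling_eq_harmonic_S poch add.commute[of p "Suc r"]
      by (rule cancel) simp
  qed
  hence "bernoulli_num (2 * k) / fact (2 * k) *
     (\<Sum>r\<le>j. real (stirling (Suc j) (Suc r)) * pochhammer (real p) (Suc r) / ln x ^ (p + Suc r)) =
     (\<Sum>r\<le>j. coeff_d p (Suc r) k / ln x ^ (Suc r + p))"
    unfolding sum_distrib_left by (intro sum.cong refl)
  also have "\<dots> = (\<Sum>r = 1..2 * k - 1. coeff_d p r k / ln x ^ (r + p))"
    unfolding k(1) by (rule sum.reindex_bij_witness[of _ "\<lambda>r. r - 1" Suc]) auto
  finally have sum_eq: "bernoulli_num (2 * k) / fact (2 * k) *
     (\<Sum>r\<le>j. real (stirling (Suc j) (Suc r)) * pochhammer (real p) (Suc r) / ln x ^ (p + Suc r)) =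
     (\<Sum>r = 1..2 * k - 1. coeff_d p r k / ln x ^ (r + p))" .
  have "b * (- s / y) = - (b * s * (1 / y))" for b s y :: real
    by simp
  thus ?thesis unfolding sum_eq [symmetric] unfolding k(1) deriv .
qed

definition inv_ln_power_primitive :: "nat \<Rightarrow> real \<Rightarrow> real" where
  "inv_ln_power_primitive p x =
     1 / fact (p - 1) * li x - x * (\<Sum>r = 1..p - 1. coeff_c p r / ln x ^ r)"

text \<open>
  Since \<open>x / (ln x) ^ r\<close> has the derivative \<open>1 / (ln x) ^ r - r / (ln x) ^ (r + 1)\<close>, the weights
  \<open>(r - 1)!\<close> make the sum over \<open>r\<close> telescope to \<open>1 / ln x - (p - 1)! / (ln x) ^ p\<close>, and the first
  term is the derivative of \<open>li\<close>.
\<close>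

lemma has_real_derivative_inv_ln_power_primitive:
  assumes "p \<ge> 1" and x: "x > 1"
  shows "(inv_ln_power_primitive p has_real_derivative 1 / ln x ^ p) (at x)"
proof -
  have deriv: "((\<lambda>y. \<Sum>r = 1..p - 1. coeff_c p r * (1 / ln y ^ r)) has_real_derivative
        (\<Sum>r = 1..p - 1. coeff_c p r * (- (real r / ln x ^ Suc r) / x))) (at x)"
    by (intro DERIV_sum DERIV_cmult has_real_derivative_inv_ln_power x)
  have tele: "(\<Sum>r = 1..q. fact (r - 1) * (1 / ln x ^ r - real r / ln x ^ Suc r)) =
              1 / ln x - fact q / ln x ^ Suc q" for q
    by (induction q) (simp_all add: field_simps)
  have "(\<Sum>r = 1..p - 1. coeff_c p r * (1 / ln x ^ r - real r / ln x ^ Suc r)) =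
        (\<Sum>r = 1..p - 1. fact (r - 1) * (1 / ln x ^ r - real r / ln x ^ Suc r)) / fact (p - 1)"
    by (simp add: coeff_c_def sum_divide_distrib)
  also have "\<dots> = 1 / fact (p - 1) * (1 / ln x) - 1 / ln x ^ p"
    using \<open>p \<ge> 1\<close> by (simp only: tele diff_divide_distrib) simp
  finally have tele': "(\<Sum>r = 1..p - 1. coeff_c p r * (1 / ln x ^ r - real r / ln x ^ Suc r)) =
      1 / fact (p - 1) * (1 / ln x) - 1 / ln x ^ p" .
  have "((\<lambda>y. 1 / fact (p - 1) * li y - y * (\<Sum>r = 1..p - 1. coeff_c p r * (1 / ln y ^ r)))
     has_real_derivative
       1 / fact (p - 1) * (1 / ln x) - (1 * (\<Sum>r = 1..p - 1. coeff_c p r * (1 / ln x ^ r)) +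
         (\<Sum>r = 1..p - 1. coeff_c p r * (- (real r / ln x ^ Suc r) / x)) * x)) (at x)"
    by (intro DERIV_diff DERIV_cmult has_real_derivative_li x DERIV_mult DERIV_ident deriv)
  moreover have "1 * (\<Sum>r = 1..p - 1. coeff_c p r * (1 / ln x ^ r)) +
         (\<Sum>r = 1..p - 1. coeff_c p r * (- (real r / ln x ^ Suc r) / x)) * x =
      (\<Sum>r = 1..p - 1. coeff_c p r * (1 / ln x ^ r - real r / ln x ^ Suc r))"
    unfolding sum_distrib_right sum_distrib_left sum.distrib[symmetric]
    using x by (intro sum.cong refl) (simp add: right_diff_distrib)
  ultimately show ?thesis
    unfolding tele' by (simp add: inv_ln_power_primitive_def [abs_def])
qed

section \<open>The asymptotic expansion\<close>

lemma sum_bernoulli_even: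
  assumes "m \<ge> 1"
  shows "(\<Sum>j<2 * m + 1. bernoulli_num j / fact j * g j) =
           g 0 - 1 / 2 * g 1 + (\<Sum>k = 1..m. bernoulli_num (2 * k) / fact (2 * k) * g (2 * k))"
  using assms
proof (induction m rule: nat_induct_at_least)
  case base
  show ?case by (simp add: eval_nat_numeral)
next
  case (Suc m)
  have "2 * Suc m + 1 = Suc (Suc (2 * m + 1))" by simp
  moreover have "bernoulli_num (2 * m + 1) = 0"
    using Suc.hyps by (intro bernoulli_num_odd_eq_0) auto
  ultimately show ?case
    using Suc.IH by (simp del: bernoulli_num.simps fact_Suc)
qed

text \<open>
  The constant \<open>C\<close> obtained here may depend on \<open>m\<close>. That \<open>C\<close> is a limit, and not merely a number
  with the stated error bound, is what identifies the constants for different \<open>m\<close> afterwards.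
\<close>

lemma euler_maclaurin_inv_ln_power:
  fixes p m :: nat
  assumes "p \<ge> 1" "m \<ge> 1"
  defines "E \<equiv> \<lambda>n::nat.
       (\<Sum>k = 2..n - 1. 1 / ln (real k) ^ p) -
       (inv_ln_power_primitive p (real n)
        - 1 / 2 * (1 / ln (real n) ^ p)
        - (\<Sum>k = 1..m. (\<Sum>r = 1..2 * k - 1. coeff_d p r k / ln (real n) ^ (r + p))
             * (1 / real n ^ (2 * k - 1))))"
  shows "\<exists>C. E \<longlonglongrightarrow> C \<and> (\<lambda>n. E n - C) \<in> O(\<lambda>n. 1 / real n ^ (2 * m))"
proof -
  define D where "D j = (case j of 0 \<Rightarrow> inv_ln_power_primitive p | Suc i \<Rightarrow> inv_ln_power_deriv p i)" for j
  \<comment> \<open>The Bernoulli terms up to index \<open>2 * m\<close>; the step remainder is then governed by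
      \<open>D (Suc N)\<close>, the derivative of order \<open>2 * m + 1\<close> of the summand.\<close>
  define N where "N = 2 * m + 1"
  define A where "A n = (\<Sum>k = 2..n - 1. 1 / ln (real k) ^ p)" for n :: nat
  have D1: "D 1 x = 1 / ln x ^ p" for x by (simp add: D_def inv_ln_power_deriv_def)
  have deriv: "(D j has_real_derivative D (Suc j) x) (at x)" if "x > 1" for j x
    using that assms(1)
    by (cases j) (auto simp: D_def inv_ln_power_deriv_def[of p 0]
          intro!: has_real_derivative_inv_ln_power_deriv has_real_derivative_inv_ln_power_primitive)
  have E: "E n = A n - (\<Sum>j<N. bernoulli_num j / fact j * D j (real n))" for n
  proof -
    have "(\<Sum>k = 1..m. bernoulli_num (2 * k) / fact (2 * k) * D (2 * k) (real n)) =
      (\<Sum>k = 1..m. - ((\<Sum>r = 1..2 * k - 1. coeff_d p r k / ln (real n) ^ (r + p))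
             * (1 / real n ^ (2 * k - 1))))"
    proof (intro sum.cong refl)
      fix k assume k: "k \<in> {1..m}"
      have "D (2 * k) = inv_ln_power_deriv p (2 * k - 1)"
        using k by (auto simp: D_def split: nat.splits)
      thus "bernoulli_num (2 * k) / fact (2 * k) * D (2 * k) (real n) =
        - ((\<Sum>r = 1..2 * k - 1. coeff_d p r k / ln (real n) ^ (r + p)) * (1 / real n ^ (2 * k - 1)))"
        using bernoulli_term_eq[of p k "real n"] k assms(1) by simp
    qed
    moreover have "D 0 = inv_ln_power_primitive p" by (simp add: D_def)
    ultimately show ?thesis
      unfolding E_def N_def A_def sum_bernoulli_even[OF assms(2)] by (simp only: D1 sum_negf)
  qed
  define c where "c = (\<Sum>r\<le>N. real (stirling N r) * pochhammer (real p) r)"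
  define K where "K = (\<Sum>j<N. \<bar>bernoulli_num j\<bar> / fact j) * c"
  have c: "c \<ge> 0" by (simp add: c_def pochhammer_of_nat sum_nonneg)
  have "\<bar>E (Suc n) - E n\<bar> \<le> K / real n ^ Suc (2 * m)" if n: "n \<ge> 3" for n
  proof -
    have "{2..Suc n - 1} = insert n {2..n - 1}" using n by auto
    hence "A (Suc n) = A n + D 1 (real n)" using n by (simp add: A_def D1 del: One_nat_def)
    hence "E (Suc n) - E n =
        - ((\<Sum>j<N. bernoulli_num j / fact j * (D j (real n + 1) - D j (real n))) - D 1 (real n))"
      by (simp add: E right_diff_distrib sum_subtractf add_ac)
    hence "\<bar>E (Suc n) - E n\<bar> =
        \<bar>(\<Sum>j<N. bernoulli_num j / fact j * (D j (real n + 1) - D j (real n))) - D 1 (real n)\<bar>"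
      by simp
    also have "\<dots> \<le> (\<Sum>j<N. \<bar>bernoulli_num j\<bar> / fact j) * (c / real n ^ N)"
    proof (rule euler_maclaurin_step)
      fix t :: real assume t: "real n \<le> t"
      have "\<bar>D (Suc N) t\<bar> \<le> c / t ^ N"
        using abs_inv_ln_power_deriv_le[of t p N] t n by (simp add: D_def c_def)
      also have "\<dots> \<le> c / real n ^ N"
        using t n c by (intro divide_left_mono power_mono) auto
      finally show "\<bar>D (Suc N) t\<bar> \<le> c / real n ^ N" .
    qed (use n deriv in \<open>auto simp: N_def\<close>)
    finally show ?thesis by (simp add: K_def N_def)
  qed
  then obtain C where C: "E \<longlonglongrightarrow> C" "\<forall>n\<ge>3. \<bar>E n - C\<bar> \<le> 2 * K / real n ^ (2 * m)"
    using limit_rate_of_increments[of "2 * m" 3 E K] assms(2) by auto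
  have "(\<lambda>n. E n - C) \<in> O(\<lambda>n. 1 / real n ^ (2 * m))"
    using C(2) by (intro bigoI[of _ "2 * K"] eventually_sequentiallyI[of 3]) auto
  with C(1) show ?thesis by blast
qed

theorem lemma7p1:
  fixes p :: nat
  assumes "p \<ge> 1"
  shows "\<exists>C::real. \<forall>m::nat. m \<ge> 1 \<longrightarrow>
    (\<lambda>n::nat.
       (\<Sum>k = 2..n - 1. 1 / ln (real k) ^ p) -
       (1 / fact (p - 1) * li (real n)
        - real n * (\<Sum>r = 1..p - 1. coeff_c p r / ln (real n) ^ r)
        + C
        - 1 / 2 * (1 / ln (real n) ^ p)
        - (\<Sum>k = 1..m. (\<Sum>r = 1..2 * k - 1. coeff_d p r k / ln (real n) ^ (r + p))
             * (1 / real n ^ (2 * k - 1)))))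
    \<in> O(\<lambda>n. 1 / real n ^ (2 * m))"
proof -
  define B where "B k n = (\<Sum>r = 1..2 * k - 1. coeff_d p r k / ln (real n) ^ (r + p))
             * (1 / real n ^ (2 * k - 1))" for k n :: nat
  define E where "E m n =
       (\<Sum>k = 2..n - 1. 1 / ln (real k) ^ p) -
       (inv_ln_power_primitive p (real n) - 1 / 2 * (1 / ln (real n) ^ p) - (\<Sum>k = 1..m. B k n))"
    for m n :: nat
  have expansion: "\<exists>C. E m \<longlonglongrightarrow> C \<and> (\<lambda>n. E m n - C) \<in> O(\<lambda>n. 1 / real n ^ (2 * m))"
    if "m \<ge> 1" for m
    using euler_maclaurin_inv_ln_power[OF assms that] unfolding E_def B_def .
  have B: "B k \<longlonglongrightarrow> 0" if "k \<ge> 1" for k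
  proof -
    have "(\<lambda>n. (\<Sum>r = 1..2 * k - 1. coeff_d p r k * (1 / ln (real n) ^ (r + p)))
             * (1 / real n ^ (2 * k - 1))) \<longlonglongrightarrow>
          (\<Sum>r = 1..2 * k - 1. coeff_d p r k * 0) * 0"
    proof (intro tendsto_intros)
      fix r :: nat assume "r \<in> {1..2 * k - 1}"
      hence "r + p > 0" by simp
      have "(\<lambda>n. 1 / ln (real n)) \<longlonglongrightarrow> 0" by real_asymp
      hence "(\<lambda>n. (1 / ln (real n)) ^ (r + p)) \<longlonglongrightarrow> 0"
        using \<open>r + p > 0\<close> by (rule tendsto_null_power)
      thus "(\<lambda>n. 1 / ln (real n) ^ (r + p)) \<longlonglongrightarrow> 0" by (simp add: power_divide)
    next
      have "2 * k - 1 > 0" using that by simp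
      hence "(\<lambda>n. (1 / real n) ^ (2 * k - 1)) \<longlonglongrightarrow> 0"
        by (intro tendsto_null_power lim_1_over_n)
      thus "(\<lambda>n. 1 / real n ^ (2 * k - 1)) \<longlonglongrightarrow> 0" by (simp add: power_divide)
    qed
    thus ?thesis by (simp add: B_def [abs_def])
  qed
  obtain C where C: "E 1 \<longlonglongrightarrow> C" using expansion[of 1] by blast
  show ?thesis
  proof (intro exI[of _ C] allI impI)
    fix m :: nat assume m: "m \<ge> 1"
    obtain C' where C': "E m \<longlonglongrightarrow> C'" "(\<lambda>n. E m n - C') \<in> O(\<lambda>n. 1 / real n ^ (2 * m))"
      using expansion[OF m] by blast
    have "(\<lambda>n. E 1 n + ((\<Sum>k = 1..m. B k n) - (\<Sum>k = 1..1. B k n))) \<longlonglongrightarrow>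
            C + ((\<Sum>k = 1..m. 0) - (\<Sum>k = 1..1::nat. 0))"
      by (intro tendsto_intros C B) auto
    moreover have "E m = (\<lambda>n. E 1 n + ((\<Sum>k = 1..m. B k n) - (\<Sum>k = 1..1. B k n)))"
      by (simp add: E_def fun_eq_iff)
    ultimately have "E m \<longlonglongrightarrow> C" by simp
    hence "C' = C" using C'(1) LIMSEQ_unique by blast
    with C'(2) show "(\<lambda>n::nat.
       (\<Sum>k = 2..n - 1. 1 / ln (real k) ^ p) -
       (1 / fact (p - 1) * li (real n)
        - real n * (\<Sum>r = 1..p - 1. coeff_c p r / ln (real n) ^ r)
        + C
        - 1 / 2 * (1 / ln (real n) ^ p)
        - (\<Sum>k = 1..m. (\<Sum>r = 1..2 * k - 1. coeff_d p r k / ln (real n) ^ (r + p))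
             * (1 / real n ^ (2 * k - 1)))))
      \<in> O(\<lambda>n. 1 / real n ^ (2 * m))"
      by (simp add: E_def B_def inv_ln_power_primitive_def algebra_simps)
  qed
qed

end
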